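(* Let $A\in\mathbb{R}^{m\times n}$ and $b\in\mathbb{R}^m$. For $\lambda>0$, put $B_\lambda=A^TA+\lambda I\in\mathbb{R}^{n\times n}$. If, for $\lambda>0$, $B_\lambda=M_\lambda-N_\lambda$ is a weak splitting of the first type (respectively, of the second type) of $B_\lambda$ with $\lim_{\lambda\to 0}B_\lambda^{-1}N_\lambda\ge 0$ (respectively, $\lim_{\lambda\to 0}N_\lambda B_\lambda^{-1}\ge 0$), then the iterative scheme $$x^{k+1}=M_\lambda^{-1}N_\lambda x^k+M_\lambda^{-1}A^Tb$$ converges to $B_\lambda^{-1}A^Tb$, which becomes $A^\dagger b$ as $\lambda\to 0$.
   Context: Matrix inequalities are entrywise: $X\ge 0$ means all entries of $X$ are nonnegative. $A^\dagger$ is the Moore-Penrose inverse of $A$. For nonsingular $B\in\mathbb{R}^{n\times n}$, a decomposition $B=U-V$ with $U$ nonsingular is a weak splitting of the first type if $U^{-1}V\ge 0$, and a weak splitting of the second type if $VU^{-1}\ge 0$. $\lim_{\lambda\to0}$ denotes the limit as $\lambda\to 0$ through positive values (entrywise for matrices).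
   Formalization: Convergence of the scheme is proved for all sufficiently small λ>0 rather than for every λ>0; for every λ it is false, e.g. A=0, b=0, n=m=1, with M=λ, N=0 for λ<1 and M=−λ, N=−2λ for λ≥1. *)

theory Defs
  imports "HOL-Analysis.Analysis"
begin

text \<open>
  The library order on \<^typ>\<open>real ^ 'n ^ 'm\<close> is the componentwise one, so
  \<open>0 \<le> X\<close> says that all entries of \<open>X\<close> are nonnegative.
\<close>

definition is_moore_penrose_inverse :: "real ^ 'n ^ 'm \<Rightarrow> real ^ 'm ^ 'n \<Rightarrow> bool" where
  "is_moore_penrose_inverse A X \<longleftrightarrow>
     A ** X ** A = A \<and>
     X ** A ** X = X \<and>
     transpose (A ** X) = A ** X \<and>
     transpose (X ** A) = X ** A"

definition moore_penrose_inverse :: "real ^ 'n ^ 'm \<Rightarrow> real ^ 'm ^ 'n" where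
  "moore_penrose_inverse A = (THE X. is_moore_penrose_inverse A X)"

lemma is_moore_penrose_inverse_unique:
  assumes X: "is_moore_penrose_inverse A X" and Y: "is_moore_penrose_inverse A Y"
  shows "X = Y"
proof -
  have "A ** X = transpose (A ** X)"
    using X by (simp add: is_moore_penrose_inverse_def)
  also have "\<dots> = transpose ((A ** Y) ** (A ** X))"
    using Y by (simp add: is_moore_penrose_inverse_def matrix_mul_assoc)
  also have "\<dots> = (A ** X) ** (A ** Y)"
    using X Y by (simp add: is_moore_penrose_inverse_def matrix_transpose_mul[of "A ** Y"])
  also have "\<dots> = A ** Y"
    using X by (simp add: is_moore_penrose_inverse_def matrix_mul_assoc)
  finally have AX: "A ** X = A ** Y" .
  have "X ** A = transpose (X ** A)"
    using X by (simp add: is_moore_penrose_inverse_def)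
  also have "\<dots> = transpose ((X ** A) ** (Y ** A))"
    using Y by (metis is_moore_penrose_inverse_def matrix_mul_assoc)
  also have "\<dots> = (Y ** A) ** (X ** A)"
    using X Y by (simp add: is_moore_penrose_inverse_def matrix_transpose_mul[of "X ** A"])
  also have "\<dots> = Y ** A"
    using X by (metis is_moore_penrose_inverse_def matrix_mul_assoc)
  finally have XA: "X ** A = Y ** A" .
  have "X = X ** A ** X"
    using X by (simp add: is_moore_penrose_inverse_def)
  also have "\<dots> = Y ** (A ** X)"
    by (simp add: XA matrix_mul_assoc)
  also have "\<dots> = Y ** A ** Y"
    by (simp add: AX matrix_mul_assoc)
  also have "\<dots> = Y"
    using Y by (simp add: is_moore_penrose_inverse_def)
  finally show ?thesis .
qed

text \<open>
  Splittings \<open>B = U - V\<close> of a nonsingular matrix \<open>B\<close>.  Nonsingularity of \<open>B\<close> is a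
  standing assumption on \<open>B\<close> and not a condition on the decomposition; for the
  matrices \<open>regularized_gram A \<mu>\<close> with \<open>\<mu> > 0\<close> it always holds
  (\<open>invertible_regularized_gram\<close>).
\<close>

definition weak_splitting_first ::
    "real ^ 'n ^ 'n \<Rightarrow> real ^ 'n ^ 'n \<Rightarrow> real ^ 'n ^ 'n \<Rightarrow> bool" where
  "weak_splitting_first B U V \<longleftrightarrow>
     B = U - V \<and> invertible U \<and> 0 \<le> matrix_inv U ** V"

definition weak_splitting_second ::
    "real ^ 'n ^ 'n \<Rightarrow> real ^ 'n ^ 'n \<Rightarrow> real ^ 'n ^ 'n \<Rightarrow> bool" where
  "weak_splitting_second B U V \<longleftrightarrow>
     B = U - V \<and> invertible U \<and> 0 \<le> V ** matrix_inv U"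

definition regularized_gram :: "real ^ 'n ^ 'm \<Rightarrow> real \<Rightarrow> real ^ 'n ^ 'n" where
  "regularized_gram A \<mu> = transpose A ** A + \<mu> *\<^sub>R mat 1"

lemma nonneg_matrix_iff:
  fixes X :: "real ^ 'n ^ 'm"
  shows "0 \<le> X \<longleftrightarrow> (\<forall>i j. 0 \<le> X $ i $ j)"
  by (simp add: less_eq_vec_def)

lemma invertible_regularized_gram:
  assumes "\<mu> > 0"
  shows "invertible (regularized_gram A \<mu>)"
proof -
  have "x = 0" if "regularized_gram A \<mu> *v x = 0" for x
  proof -
    have "0 = x \<bullet> (regularized_gram A \<mu> *v x)"
      using that by simp
    also have "\<dots> = x \<bullet> (transpose A *v (A *v x)) + \<mu> * (x \<bullet> x)"
      by (simp add: regularized_gram_def matrix_vector_mult_add_rdistrib inner_add_right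
          matrix_vector_mul_assoc flip: scaleR_matrix_vector_assoc)
    also have "x \<bullet> (transpose A *v (A *v x)) = (A *v x) \<bullet> (A *v x)"
      by (simp add: dot_lmul_matrix[symmetric] inner_commute)
    finally have "\<mu> * (x \<bullet> x) = - ((A *v x) \<bullet> (A *v x))"
      by simp
    then have "\<mu> * (x \<bullet> x) \<le> 0"
      by simp
    with assms have "x \<bullet> x \<le> 0"
      by (simp add: mult_le_0_iff)
    then show "x = 0"
      by (metis inner_gt_zero_iff not_le)
  qed
  then show ?thesis
    by (simp add: invertible_left_inverse matrix_left_invertible_ker)
qed

end

theory Submission
  imports Defs
begin

text \<open>
  Put \<open>T = M\<^sup>-\<^sup>1N\<close> and \<open>G = B\<^sup>-\<^sup>1N\<close> for a splitting \<open>B = M - N\<close> of the first type.  Then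
  \<open>(I - T)(I + G) = I\<close>, so the row sums \<open>h = (I + G)e\<close> of \<open>I + G\<close> satisfy \<open>Th = h - e < h\<close>.
  As \<open>G\<close> tends to a nonnegative matrix, \<open>h > 0\<close> for small \<open>\<mu>\<close>, and a nonnegative matrix that
  strictly decreases a positive vector has powers tending to \<open>0\<close>.  This replaces the
  Perron--Frobenius theorem.  For the second type the same argument applies to \<open>S = NM\<^sup>-\<^sup>1\<close>,
  and \<open>T\<^sup>k\<^sup>+\<^sup>1 = M\<^sup>-\<^sup>1S\<^sup>kN\<close>.

  For the limit \<open>\<mu> \<rightarrow> 0\<close>, write \<open>X\<close> for the Moore-Penrose inverse.  Then
  \<open>A\<^sup>T = A\<^sup>TAX\<close> and \<open>X = A\<^sup>TAY\<close> with \<open>Y = XX\<^sup>TX\<close>, hence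
  \<open>B\<^sup>-\<^sup>1A\<^sup>T = X - \<mu>Y + \<mu>(\<mu>B\<^sup>-\<^sup>1)Y\<close>, where \<open>\<mu>B\<^sup>-\<^sup>1\<close> is a contraction.
\<close>

subsection \<open>Powers of nonnegative matrices\<close>

lemma nonneg_matrix_vector_mult_abs_le:
  fixes T :: "real ^ 'n ^ 'm"
  assumes "0 \<le> T" and "\<And>j. \<bar>y $ j\<bar> \<le> z $ j"
  shows "\<bar>(T *v y) $ i\<bar> \<le> (T *v z) $ i"
proof -
  have "\<bar>(T *v y) $ i\<bar> \<le> (\<Sum>j\<in>UNIV. \<bar>T $ i $ j * y $ j\<bar>)"
    by (simp add: matrix_vector_mult_def)
  also have "\<dots> \<le> (\<Sum>j\<in>UNIV. T $ i $ j * z $ j)"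
    using assms by (intro sum_mono) (simp add: abs_mult nonneg_matrix_iff mult_left_mono)
  finally show ?thesis
    by (simp add: matrix_vector_mult_def)
qed

text \<open>There are only finitely many indices, so the strict decrease of \<open>h\<close> is
  uniform: \<open>T *v h\<close> is at most \<open>q\<close> times \<open>h\<close> with
  \<open>q < 1\<close>. By positivity \<open>h\<close> dominates \<open>y\<close> up to a constant
  \<open>C\<close>, and monotonicity of \<open>T\<close> makes the bound decay
  geometrically.\<close>

lemma nonneg_matrix_powers_tendsto_0:
  fixes T :: "real ^ 'n ^ 'n" and h y :: "real ^ 'n"
  assumes T: "0 \<le> T" and h: "\<And>i. 0 < h $ i" and Th: "\<And>i. (T *v h) $ i < h $ i"
  shows "(\<lambda>k. ((*v) T ^^ k) y) \<longlonglongrightarrow> 0"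
proof -
  \<comment> \<open>In the max norm with weights \<open>h\<close>, \<open>q\<close> is the operator
    norm of \<open>T\<close> and \<open>C\<close> is the norm of \<open>y\<close>.\<close>
  define q where "q = Max (range (\<lambda>i. (T *v h) $ i / h $ i))"
  define C where "C = Max (range (\<lambda>i. \<bar>y $ i\<bar> / h $ i))"
  have Tq: "(T *v h) $ i \<le> q * h $ i" for i
  proof -
    have "(T *v h) $ i / h $ i \<le> q"
      unfolding q_def by (intro Max_ge) auto
    then show ?thesis using h by (simp add: divide_le_eq)
  qed
  have "q < 1"
    unfolding q_def using h Th by (subst Max_less_iff) auto
  \<comment> \<open>Here \<open>undefined\<close> is just some index; index types are
    nonempty.\<close>
  moreover have "0 \<le> q"
  proof -
    have "\<bar>(T *v h) $ undefined\<bar> \<le> (T *v h) $ undefined"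
      using h by (intro nonneg_matrix_vector_mult_abs_le[OF T]) (simp add: less_imp_le)
    then have "0 \<le> q * h $ undefined"
      using Tq[of undefined] by linarith
    then show ?thesis
      using h[of undefined] by (simp add: zero_le_mult_iff)
  qed
  ultimately have q: "0 \<le> q" "q < 1" by auto
  have yC: "\<bar>y $ i\<bar> \<le> C * h $ i" for i
  proof -
    have "\<bar>y $ i\<bar> / h $ i \<le> C"
      unfolding C_def by (intro Max_ge) auto
    then show ?thesis using h by (simp add: divide_le_eq)
  qed
  have "0 \<le> C"
    using order_trans[OF abs_ge_zero yC[of undefined]] h[of undefined]
    by (simp add: zero_le_mult_iff)
  have bound: "\<bar>((*v) T ^^ k) y $ i\<bar> \<le> C * q ^ k * h $ i" for k i
  proof (induction k arbitrary: i)
    case 0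
    then show ?case by (simp add: yC)
  next
    case (Suc k)
    have "\<bar>((*v) T ^^ Suc k) y $ i\<bar> \<le> (T *v ((C * q ^ k) *\<^sub>R h)) $ i"
      using nonneg_matrix_vector_mult_abs_le[OF T, of "((*v) T ^^ k) y" "(C * q ^ k) *\<^sub>R h"] Suc
      by simp
    also have "\<dots> = C * q ^ k * (T *v h) $ i"
      by (simp add: matrix_vector_mult_scaleR)
    also have "\<dots> \<le> C * q ^ k * (q * h $ i)"
      using \<open>0 \<le> C\<close> q Tq by (intro mult_left_mono) auto
    finally show ?case by (simp add: mult_ac)
  qed
  have "(\<lambda>k. ((*v) T ^^ k) y $ i) \<longlonglongrightarrow> 0 $ i" for i
  proof -
    have "(\<lambda>k. C * q ^ k * h $ i) \<longlonglongrightarrow> C * 0 * h $ i"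
      using q by (intro tendsto_intros LIMSEQ_realpow_zero) auto
    then show ?thesis
      using Lim_null_comparison[of "\<lambda>k. ((*v) T ^^ k) y $ i" "\<lambda>k. C * q ^ k * h $ i"] bound
      by simp
  qed
  then show ?thesis by (rule vec_tendstoI)
qed

text \<open>The row sum condition says exactly that \<open>h = (I + G)e\<close> is positive, where
  \<open>e\<close> is the all-ones vector. Negative entries of \<open>G\<close> are allowed.\<close>

lemma nonneg_matrix_powers_tendsto_0_of_inverse:
  fixes T G :: "real ^ 'n ^ 'n"
  assumes T: "0 \<le> T" and inv: "(mat 1 - T) ** (mat 1 + G) = mat 1"
    and G: "\<And>i. - 1 < (\<Sum>j\<in>UNIV. G $ i $ j)"
  shows "(\<lambda>k. ((*v) T ^^ k) y) \<longlonglongrightarrow> 0"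
proof (rule nonneg_matrix_powers_tendsto_0[OF T])
  define e :: "real ^ 'n" where "e = (\<chi> i. 1)"
  define h where "h = (mat 1 + G) *v e"
  have "h $ i = 1 + (\<Sum>j\<in>UNIV. G $ i $ j)" for i
    by (simp add: h_def e_def matrix_vector_mult_add_rdistrib) (simp add: matrix_vector_mult_def)
  then show "0 < h $ i" for i
    using G[of i] by simp
  have "(mat 1 - T) *v h = e"
    unfolding h_def by (simp add: matrix_vector_mul_assoc inv)
  then have "T *v h = h - e"
    by (auto simp: matrix_vector_mult_diff_rdistrib algebra_simps)
  then show "(T *v h) $ i < h $ i" for i
    by (simp add: e_def)
qed

text \<open>The entries of \<open>G\<close> may approach a zero entry of \<open>L\<close> from
  below, so nonnegativity need not hold before the limit. The slack between 0 and -1 makes the bound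
  on row sums an open condition.\<close>

lemma eventually_row_sums_gt:
  fixes G :: "'a \<Rightarrow> real ^ 'n ^ 'm"
  assumes "(G \<longlongrightarrow> L) F" and "0 \<le> L"
  shows "\<forall>\<^sub>F \<mu> in F. \<forall>i. - 1 < (\<Sum>j\<in>UNIV. G \<mu> $ i $ j)"
proof (rule eventually_all_finite)
  fix i
  have "((\<lambda>\<mu>. \<Sum>j\<in>UNIV. G \<mu> $ i $ j) \<longlongrightarrow> (\<Sum>j\<in>UNIV. L $ i $ j)) F"
    using assms(1) by (intro tendsto_intros)
  moreover have "0 \<le> (\<Sum>j\<in>UNIV. L $ i $ j)"
    using assms(2) by (intro sum_nonneg) (simp add: nonneg_matrix_iff)
  ultimately show "\<forall>\<^sub>F \<mu> in F. - 1 < (\<Sum>j\<in>UNIV. G \<mu> $ i $ j)"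
    by (intro order_tendstoD(1)) auto
qed

subsection \<open>Convergence of splitting iterations\<close>

lemma matrix_add_rdistrib: "(B + C) ** A = B ** A + C ** A"
  for A :: "'a::semiring_1 ^ 'p ^ 'n"
  by (simp add: matrix_matrix_mult_def vec_eq_iff distrib_right sum.distrib)

lemma matrix_diff_rdistrib: "(B - C) ** A = B ** A - C ** A"
  for A :: "'a::ring_1 ^ 'p ^ 'n"
  by (simp add: matrix_matrix_mult_def vec_eq_iff left_diff_distrib sum_subtractf)

lemma matrix_diff_ldistrib: "A ** (B - C) = A ** B - A ** C"
  for A :: "'a::ring_1 ^ 'n ^ 'm"
  by (simp add: matrix_matrix_mult_def vec_eq_iff right_diff_distrib sum_subtractf)

lemma
  assumes "invertible A"
  shows matrix_inv_right: "A ** matrix_inv A = mat 1"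
    and matrix_inv_left: "matrix_inv A ** A = mat 1"
  using someI_ex[OF assms[unfolded invertible_def]] by (simp_all add: matrix_inv_def)

text \<open>The factors \<open>I - M^-1 N = M^-1 B\<close> and \<open>I + B^-1 N = B^-1 M\<close>
  are inverse to each other.\<close>

lemma weak_splitting_first_powers_tendsto_0:
  fixes B M N :: "real ^ 'n ^ 'n"
  assumes B: "invertible B" and spl: "weak_splitting_first B M N"
    and rows: "\<And>i. - 1 < (\<Sum>j\<in>UNIV. (matrix_inv B ** N) $ i $ j)"
  shows "(\<lambda>k. ((*v) (matrix_inv M ** N) ^^ k) y) \<longlonglongrightarrow> 0"
proof (rule nonneg_matrix_powers_tendsto_0_of_inverse[OF _ _ rows])
  have M: "invertible M" and BMN: "B = M - N" and nonneg: "0 \<le> matrix_inv M ** N"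
    using spl by (auto simp: weak_splitting_first_def)
  show "0 \<le> matrix_inv M ** N" by fact
  have "mat 1 - matrix_inv M ** N = matrix_inv M ** B"
    by (simp add: BMN matrix_diff_ldistrib matrix_inv_left[OF M])
  moreover have "mat 1 + matrix_inv B ** N = matrix_inv B ** M"
    using BMN by (metis B matrix_inv_left matrix_add_ldistrib diff_add_cancel)
  ultimately show "(mat 1 - matrix_inv M ** N) ** (mat 1 + matrix_inv B ** N) = mat 1"
    by (metis B M matrix_inv_left matrix_inv_right matrix_mul_assoc matrix_mul_lid)
qed

lemma weak_splitting_second_powers_tendsto_0:
  fixes B M N :: "real ^ 'n ^ 'n"
  assumes B: "invertible B" and spl: "weak_splitting_second B M N"
    and rows: "\<And>i. - 1 < (\<Sum>j\<in>UNIV. (N ** matrix_inv B) $ i $ j)"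
  shows "(\<lambda>k. ((*v) (matrix_inv M ** N) ^^ k) y) \<longlonglongrightarrow> 0"
proof -
  have M: "invertible M" and BMN: "B = M - N" and nonneg: "0 \<le> N ** matrix_inv M"
    using spl by (auto simp: weak_splitting_second_def)
  have "mat 1 - N ** matrix_inv M = B ** matrix_inv M"
    by (simp add: BMN matrix_diff_rdistrib matrix_inv_right[OF M])
  moreover have "mat 1 + N ** matrix_inv B = M ** matrix_inv B"
    using BMN by (metis B matrix_inv_right matrix_add_rdistrib diff_add_cancel)
  ultimately have inv: "(mat 1 - N ** matrix_inv M) ** (mat 1 + N ** matrix_inv B) = mat 1"
    by (metis B M matrix_inv_left matrix_inv_right matrix_mul_assoc matrix_mul_lid)
  \<comment> \<open>Regrouping \<open>(M^-1 N)^(k+1)\<close> leaves one outer \<open>M^-1\<close>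
    and one inner \<open>N\<close>, so only \<open>k\<close> copies of the nonnegative matrix
    \<open>N M^-1\<close> remain.\<close>
  have shift: "((*v) (matrix_inv M ** N) ^^ Suc k) y
      = matrix_inv M *v (((*v) (N ** matrix_inv M) ^^ k) (N *v y))" for k
    by (induction k) (simp_all add: matrix_vector_mul_assoc matrix_mul_assoc)
  have "(\<lambda>k. ((*v) (N ** matrix_inv M) ^^ k) (N *v y)) \<longlonglongrightarrow> 0"
    by (rule nonneg_matrix_powers_tendsto_0_of_inverse[OF nonneg inv rows])
  then have "(\<lambda>k. matrix_inv M *v (((*v) (N ** matrix_inv M) ^^ k) (N *v y)))
      \<longlonglongrightarrow> matrix_inv M *v 0"
    by (rule bounded_linear.tendsto[OF matrix_vector_mul_bounded_linear])
  then have "(\<lambda>k. ((*v) (matrix_inv M ** N) ^^ Suc k) y) \<longlonglongrightarrow> 0"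
    unfolding shift by simp
  then show ?thesis by (rule LIMSEQ_imp_Suc)
qed

text \<open>The target \<open>s\<close> is a fixed point of the affine iteration, so the error
  \<open>x k - s\<close> is multiplied by \<open>M^-1 N\<close> at each step.\<close>

lemma splitting_iteration_tendsto:
  fixes B M N :: "real ^ 'n ^ 'n" and C :: "real ^ 'm ^ 'n"
  assumes B: "invertible B" and M: "invertible M" and BMN: "B = M - N"
    and powers: "\<And>y. (\<lambda>k. ((*v) (matrix_inv M ** N) ^^ k) y) \<longlonglongrightarrow> 0"
    and x: "\<And>k. x (Suc k) = (matrix_inv M ** N) *v x k + (matrix_inv M ** C) *v b"
  shows "x \<longlonglongrightarrow> (matrix_inv B ** C) *v b"
proof -
  define s where "s = (matrix_inv B ** C) *v b"
  have "B *v s = C *v b"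
    by (simp add: s_def matrix_vector_mul_assoc matrix_mul_assoc matrix_inv_right[OF B])
  then have Cb: "C *v b = M *v s - N *v s"
    by (simp add: BMN matrix_vector_mult_diff_rdistrib)
  have "matrix_inv M *v (M *v s) = s"
    by (simp add: matrix_vector_mul_assoc matrix_inv_left[OF M])
  then have step: "x (Suc k) - s = (matrix_inv M ** N) *v (x k - s)" for k
    by (simp add: x Cb matrix_vector_mult_diff_distrib flip: matrix_vector_mul_assoc)
  have "x k - s = ((*v) (matrix_inv M ** N) ^^ k) (x 0 - s)" for k
    by (induction k) (simp_all add: step)
  then have "(\<lambda>k. x k - s) = (\<lambda>k. ((*v) (matrix_inv M ** N) ^^ k) (x 0 - s))"
    by (rule ext)
  then have "(\<lambda>k. x k - s) \<longlonglongrightarrow> 0"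
    using powers by metis
  then show ?thesis
    unfolding s_def by (rule LIM_zero_cancel)
qed

subsection \<open>The Moore-Penrose inverse as a regularized limit\<close>

declare transpose_matrix_vector [simp del]

lemma inner_transpose_vector: "x \<bullet> (transpose A *v y) = (A *v x) \<bullet> y"
  for A :: "real ^ 'n ^ 'm"
  by (simp add: transpose_matrix_vector inner_commute flip: dot_lmul_matrix)

text \<open>Project \<open>b\<close> orthogonally onto the range of \<open>A\<close>; the transpose
  of \<open>A\<close> annihilates the residual \<open>z\<close>.\<close>

lemma normal_equations_solvable:
  fixes A :: "real ^ 'n ^ 'm"
  shows "\<exists>x. transpose A *v (A *v x) = transpose A *v b"
proof -
  obtain y z where y: "y \<in> span (range ((*v) A))"
    and z: "\<And>w. w \<in> span (range ((*v) A)) \<Longrightarrow> orthogonal z w" and b: "b = y + z"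
    using orthogonal_subspace_decomp_exists[of "range ((*v) A)" b] by blast
  have "span (range ((*v) A)) = range ((*v) A)"
    by (simp add: span_eq_iff linear_subspace_image)
  with y obtain x where x: "y = A *v x" by auto
  have "(transpose A *v z) \<bullet> (transpose A *v z) = z \<bullet> (A *v (transpose A *v z))"
    by (simp only: inner_transpose_vector inner_commute)
  also have "\<dots> = 0"
    using z[OF span_base, of "A *v (transpose A *v z)"] by (simp add: orthogonal_def)
  finally have "transpose A *v z = 0"
    by simp
  then show ?thesis
    by (auto simp: b x matrix_vector_right_distrib)
qed

text \<open>Column \<open>j\<close> of \<open>P\<close> is a least squares solution for the
  \<open>j\<close>-th unit vector.\<close>

lemma normal_equations_solvable_matrix:
  fixes A :: "real ^ 'n ^ 'm"
  shows "\<exists>P. transpose A ** A ** P = transpose A"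
proof -
  obtain p where p: "\<And>j. transpose A *v (A *v p j) = transpose A *v axis j 1"
    using normal_equations_solvable[of A "axis _ 1"] by metis
  define P where "P = (\<chi> i j. p j $ i)"
  have "P *v axis j 1 = p j" for j
    by (simp add: P_def matrix_vector_mul_component vec_eq_iff matrix_vector_mult_basis column_def)
  then have "(transpose A ** A ** P) *v axis j 1 = transpose A *v axis j 1" for j
    by (simp add: p flip: matrix_vector_mul_assoc)
  then have "column j (transpose A ** A ** P) = column j (transpose A)" for j
    by (simp add: matrix_vector_mult_basis)
  then show ?thesis
    by (intro exI[of _ P]) (simp add: vec_eq_iff column_def)
qed

text \<open>If \<open>A^T A P = A^T\<close>, transposing gives \<open>P^T A^T A = A\<close>. Hence
  \<open>A P = P^T A^T A P = P^T A^T\<close>, which is symmetric and satisfies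
  \<open>A P A = A\<close>.\<close>

lemma inner_inverse_13_exists:
  fixes A :: "real ^ 'n ^ 'm"
  shows "\<exists>P. A ** P ** A = A \<and> transpose (A ** P) = A ** P"
proof -
  obtain P where P: "transpose A ** A ** P = transpose A"
    using normal_equations_solvable_matrix by blast
  have PA: "transpose P ** transpose A ** A = A"
    using arg_cong[OF P, of transpose] by (simp add: matrix_transpose_mul matrix_mul_assoc)
  have "A ** P = transpose P ** transpose A ** A ** P"
    by (simp add: PA)
  also have "\<dots> = transpose P ** transpose A"
    by (metis P matrix_mul_assoc)
  finally show ?thesis
    using PA by (intro exI[of _ P]) (simp add: matrix_transpose_mul)
qed

lemma is_moore_penrose_inverse_exists:
  fixes A :: "real ^ 'n ^ 'm"
  shows "\<exists>X. is_moore_penrose_inverse A X"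
proof -
  obtain P where P: "A ** P ** A = A" "transpose (A ** P) = A ** P"
    using inner_inverse_13_exists by blast
  \<comment> \<open>Transposing an inverse of this kind for \<open>A^T\<close> gives
    \<open>R\<close> with \<open>A R A = A\<close> and \<open>R A\<close> symmetric. The product
    \<open>R A P\<close> then inherits \<open>A P\<close> and \<open>R A\<close> as its two
    projections.\<close>
  obtain Q where Q: "transpose A ** Q ** transpose A = transpose A"
      "transpose (transpose A ** Q) = transpose A ** Q"
    using inner_inverse_13_exists by blast
  define R where "R = transpose Q"
  have R1: "A ** R ** A = A"
    using arg_cong[OF Q(1), of transpose]
    by (simp add: R_def matrix_transpose_mul matrix_mul_assoc)
  have R2: "transpose (R ** A) = R ** A"
    using Q(2) by (simp add: R_def matrix_transpose_mul)
  have "A ** (R ** A ** P) = A ** P" "(R ** A ** P) ** A = R ** A"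
    using R1 P(1) by (metis matrix_mul_assoc)+
  moreover have "(R ** A) ** (R ** A ** P) = R ** A ** P"
    using R1 by (metis matrix_mul_assoc)
  ultimately have "is_moore_penrose_inverse A (R ** A ** P)"
    using P R2 by (simp add: is_moore_penrose_inverse_def)
  then show ?thesis ..
qed

lemma moore_penrose_inverse_is: "is_moore_penrose_inverse A (moore_penrose_inverse A)"
proof -
  have "\<exists>!X. is_moore_penrose_inverse A X"
    using is_moore_penrose_inverse_exists[of A] is_moore_penrose_inverse_unique[of A] by blast
  then show ?thesis
    unfolding moore_penrose_inverse_def by (rule theI')
qed

section \<open>Quantitative limit of the regularized solutions\<close>

lemma regularized_gram_mult_vector:
  "regularized_gram A \<mu> *v x = transpose A *v (A *v x) + \<mu> *\<^sub>R x"
  by (simp add: regularized_gram_def matrix_vector_mult_add_rdistrib matrix_vector_mul_assoc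
      scaleR_matrix_vector_assoc[symmetric])

text \<open>Pair with \<open>x\<close> and apply Cauchy-Schwarz. This bounds
  \<open>\<mu> B^-1\<close> by 1 in operator norm, uniformly in \<open>\<mu>\<close>.\<close>

lemma norm_regularized_gram_ge:
  fixes A :: "real ^ 'n ^ 'm"
  assumes "0 < \<mu>"
  shows "\<mu> * norm x \<le> norm (regularized_gram A \<mu> *v x)"
proof (cases "x = 0")
  case False
  have "\<mu> * (norm x * norm x) \<le> (A *v x) \<bullet> (A *v x) + \<mu> * (x \<bullet> x)"
    by (simp add: dot_square_norm power2_eq_square)
  also have "\<dots> = x \<bullet> (regularized_gram A \<mu> *v x)"
    by (simp add: regularized_gram_mult_vector inner_add_right inner_transpose_vector)
  also have "\<dots> \<le> norm x * norm (regularized_gram A \<mu> *v x)"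
    by (rule norm_cauchy_schwarz)
  finally show ?thesis
    using False by (simp add: mult.left_commute)
qed simp

lemma regularized_gram_inverse_tendsto_moore_penrose:
  fixes A :: "real ^ 'n ^ 'm"
  shows "((\<lambda>\<mu>. (matrix_inv (regularized_gram A \<mu>) ** transpose A) *v b)
    \<longlongrightarrow> moore_penrose_inverse A *v b) (at_right 0)"
proof -
  define X where "X = moore_penrose_inverse A"
  \<comment> \<open>Chosen so that \<open>X b = A^T A y\<close>: combine
    \<open>X = A^T X^T X\<close> with \<open>A^T = A^T A X\<close>.\<close>
  define y where "y = X *v (transpose X *v (X *v b))"
  let ?B = "regularized_gram A"
  have X: "A ** X ** A = A" "X ** A ** X = X" "transpose (A ** X) = A ** X"
      "transpose (X ** A) = X ** A"
    using moore_penrose_inverse_is[of A] by (auto simp: X_def is_moore_penrose_inverse_def)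
  have AX: "transpose A ** A ** X = transpose A"
    by (metis X(1,3) matrix_mul_assoc matrix_transpose_mul)
  have "transpose A ** transpose X ** X = X"
    by (metis X(2,4) matrix_transpose_mul)
  then have "X *v b = transpose A *v (transpose X *v (X *v b))"
    by (simp add: matrix_vector_mul_assoc matrix_mul_assoc)
  also have "\<dots> = transpose A *v (A *v y)"
    using AX by (simp add: y_def matrix_vector_mul_assoc matrix_mul_assoc)
  finally have Xb: "X *v b = transpose A *v (A *v y)" .
  have bound: "norm ((matrix_inv (?B \<mu>) ** transpose A) *v b - X *v b) \<le> \<mu> * (2 * norm y)"
    if "0 < \<mu>" for \<mu>
  proof -
    note inv = invertible_regularized_gram[OF that, of A]
    define r where "r = matrix_inv (?B \<mu>) *v y"
    have Br: "?B \<mu> *v r = y"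
      by (simp add: r_def matrix_vector_mul_assoc matrix_inv_right[OF inv])
    \<comment> \<open>Since \<open>B y = X b + \<mu> y\<close> and \<open>B r = y\<close>, all terms
      except \<open>A^T A X b = A^T b\<close> cancel.\<close>
    have "?B \<mu> *v (X *v b - \<mu> *\<^sub>R y + \<mu> *\<^sub>R \<mu> *\<^sub>R r)
        = transpose A *v (A *v (X *v b)) + \<mu> *\<^sub>R (X *v b) - \<mu> *\<^sub>R (?B \<mu> *v y) + \<mu> *\<^sub>R \<mu> *\<^sub>R (?B \<mu> *v r)"
      by (simp add: matrix_vector_right_distrib matrix_vector_mult_diff_distrib
          matrix_vector_mult_scaleR regularized_gram_mult_vector[of A \<mu> "X *v b"])
    also have "\<dots> = transpose A *v (A *v (X *v b))"
      by (simp add: Br Xb regularized_gram_mult_vector[of A \<mu> y] scaleR_add_right)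
    also have "\<dots> = transpose A *v b"
      using AX by (simp add: matrix_vector_mul_assoc matrix_mul_assoc)
    finally have "matrix_inv (?B \<mu>) *v (transpose A *v b) = X *v b - \<mu> *\<^sub>R y + \<mu> *\<^sub>R \<mu> *\<^sub>R r"
      by (metis inv matrix_inv_left matrix_vector_mul_assoc matrix_vector_mul_lid)
    then have "(matrix_inv (?B \<mu>) ** transpose A) *v b - X *v b = \<mu> *\<^sub>R (\<mu> *\<^sub>R r - y)"
      by (simp add: scaleR_diff_right flip: matrix_vector_mul_assoc)
    moreover have "norm (\<mu> *\<^sub>R r - y) \<le> 2 * norm y"
      using norm_regularized_gram_ge[OF that, of r A] norm_triangle_ineq4[of "\<mu> *\<^sub>R r" y] that
      by (simp add: Br)
    ultimately show ?thesis
      using that by (simp add: mult_left_mono)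
  qed
  have "((\<lambda>\<mu>. \<mu> * (2 * norm y)) \<longlongrightarrow> 0 * (2 * norm y)) (at_right 0)"
    by (intro tendsto_intros)
  moreover have "\<forall>\<^sub>F \<mu> in at_right 0.
      norm ((matrix_inv (?B \<mu>) ** transpose A) *v b - X *v b) \<le> \<mu> * (2 * norm y)"
    using eventually_at_right_less by (rule eventually_mono) (rule bound)
  ultimately have "((\<lambda>\<mu>. (matrix_inv (?B \<mu>) ** transpose A) *v b - X *v b) \<longlongrightarrow> 0) (at_right 0)"
    using Lim_null_comparison by simp
  then show ?thesis
    unfolding X_def by (rule LIM_zero_cancel)
qed

text \<open>A limit condition at 0 controls only small positive \<open>\<mu>\<close>, hence the form
  "eventually" of the first conclusion. The start vector \<open>x 0\<close> is arbitrary.\<close>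

theorem theorem3p1:
  fixes A :: "real ^ 'n ^ 'm"
    and b :: "real ^ 'm"
    and M N :: "real \<Rightarrow> real ^ 'n ^ 'n"
  assumes
    "((\<forall>\<mu>>0. weak_splitting_first (regularized_gram A \<mu>) (M \<mu>) (N \<mu>)) \<and>
      (\<exists>L\<ge>0. ((\<lambda>\<mu>. matrix_inv (regularized_gram A \<mu>) ** N \<mu>) \<longlongrightarrow> L) (at_right 0)))
     \<or>
     ((\<forall>\<mu>>0. weak_splitting_second (regularized_gram A \<mu>) (M \<mu>) (N \<mu>)) \<and>
      (\<exists>L\<ge>0. ((\<lambda>\<mu>. N \<mu> ** matrix_inv (regularized_gram A \<mu>)) \<longlongrightarrow> L) (at_right 0)))"
  shows
    "(\<forall>\<^sub>F \<mu> in at_right 0. \<forall>x :: nat \<Rightarrow> real ^ 'n.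
        (\<forall>k. x (Suc k) = (matrix_inv (M \<mu>) ** N \<mu>) *v x k
                          + (matrix_inv (M \<mu>) ** transpose A) *v b) \<longrightarrow>
        x \<longlonglongrightarrow> (matrix_inv (regularized_gram A \<mu>) ** transpose A) *v b)
     \<and> ((\<lambda>\<mu>. (matrix_inv (regularized_gram A \<mu>) ** transpose A) *v b)
          \<longlongrightarrow> moore_penrose_inverse A *v b) (at_right 0)"
proof
  have pos: "\<forall>\<^sub>F \<mu>::real in at_right 0. 0 < \<mu>"
    by (rule eventually_at_right_less)
  \<comment> \<open>Both types of splitting lead to this common statement about powers, after which
    the argument no longer depends on the type.\<close>
  have "\<forall>\<^sub>F \<mu> in at_right 0. invertible (M \<mu>) \<and> regularized_gram A \<mu> = M \<mu> - N \<mu> \<and>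
      (\<forall>y. (\<lambda>k. ((*v) (matrix_inv (M \<mu>) ** N \<mu>) ^^ k) y) \<longlonglongrightarrow> 0)"
    using assms
  proof (elim disjE conjE exE)
    fix L
    assume spl: "\<forall>\<mu>>0. weak_splitting_first (regularized_gram A \<mu>) (M \<mu>) (N \<mu>)"
      and L: "0 \<le> L" "((\<lambda>\<mu>. matrix_inv (regularized_gram A \<mu>) ** N \<mu>) \<longlongrightarrow> L) (at_right 0)"
    show ?thesis
      using pos eventually_row_sums_gt[OF L(2,1)]
    proof eventually_elim
      case (elim \<mu>)
      then have \<mu>: "weak_splitting_first (regularized_gram A \<mu>) (M \<mu>) (N \<mu>)"
        using spl by blast
      have "(\<lambda>k. ((*v) (matrix_inv (M \<mu>) ** N \<mu>) ^^ k) y) \<longlonglongrightarrow> 0" for y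
        using elim
        by (intro weak_splitting_first_powers_tendsto_0[OF invertible_regularized_gram \<mu>]) auto
      with \<mu> show ?case
        by (simp add: weak_splitting_first_def)
    qed
  next
    fix L
    assume spl: "\<forall>\<mu>>0. weak_splitting_second (regularized_gram A \<mu>) (M \<mu>) (N \<mu>)"
      and L: "0 \<le> L" "((\<lambda>\<mu>. N \<mu> ** matrix_inv (regularized_gram A \<mu>)) \<longlongrightarrow> L) (at_right 0)"
    show ?thesis
      using pos eventually_row_sums_gt[OF L(2,1)]
    proof eventually_elim
      case (elim \<mu>)
      then have \<mu>: "weak_splitting_second (regularized_gram A \<mu>) (M \<mu>) (N \<mu>)"
        using spl by blast
      have "(\<lambda>k. ((*v) (matrix_inv (M \<mu>) ** N \<mu>) ^^ k) y) \<longlonglongrightarrow> 0" for y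
        using elim
        by (intro weak_splitting_second_powers_tendsto_0[OF invertible_regularized_gram \<mu>]) auto
      with \<mu> show ?case
        by (simp add: weak_splitting_second_def)
    qed
  qed
  then show "\<forall>\<^sub>F \<mu> in at_right 0. \<forall>x :: nat \<Rightarrow> real ^ 'n.
      (\<forall>k. x (Suc k) = (matrix_inv (M \<mu>) ** N \<mu>) *v x k
                        + (matrix_inv (M \<mu>) ** transpose A) *v b) \<longrightarrow>
      x \<longlonglongrightarrow> (matrix_inv (regularized_gram A \<mu>) ** transpose A) *v b"
    using pos
  proof eventually_elim
    case (elim \<mu>)
    then show ?case
      using splitting_iteration_tendsto[of "regularized_gram A \<mu>" "M \<mu>" "N \<mu>"]
        invertible_regularized_gram by blast
  qed
qed (rule regularized_gram_inverse_tendsto_moore_penrose)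

end
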